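(* Let $\mathrm{K}_V^{\mathbf t}$ be a complete $\mathbf t$-spread $d$-partite hypergraph with $V(\mathrm{K}_V^{\mathbf t})\subseteq[n]$ and $V=\{V_1,\dots,V_d\}$, where $|V_j|=n_j$ and $V_j=[i_j,i_j+n_j-1]$ for all $j=1,\dots,d$. Then $I(\mathrm{K}_V^{\mathbf t})$ is normally torsion-free. In particular, $I(\mathrm{K}_V^{\mathbf t})$ is normal.
   Context: Setting. Let $n,d\ge 1$ be integers, $[n]=\{1,\dots,n\}$, $[a,b]=\{k\in\mathbb{Z}:a\le k\le b\}$, and let $\mathbf t=(t_1,\dots,t_{d-1})$ be a vector of integers with $t_i\ge 1$ for all $i$. Let $V=\{V_1,\dots,V_d\}$ be a family of nonempty, pairwise disjoint subsets of $[n]$ such that $p<q$ whenever $p\in V_i$, $q\in V_j$ and $i<j$. A $\mathbf t$-spread edge is a set $\{k_1,\dots,k_d\}$ with $k_j\in V_j$ for $j=1,\dots,d$ and $k_j-k_{j-1}\ge t_{j-1}$ for $j=2,\dots,d$. The complete $\mathbf t$-spread $d$-partite hypergraph $\mathrm{K}_V^{\mathbf t}$ is the hypergraph with vertex set $V(\mathrm{K}_V^{\mathbf t})=V_1\cup\dots\cup V_d$ whose edges are all the $\mathbf t$-spread edges. Standing assumption: $\mathrm{K}_V^{\mathbf t}$ has no isolated vertices, i.e. every vertex belongs to at least one edge. Let $\mathbb{K}$ be a field and $S=\mathbb{K}[x_1,\dots,x_n]$. The edge ideal $I(\mathrm{K}_V^{\mathbf t})\subset S$ is the ideal generated by the monomials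 $x_{k_1}\cdots x_{k_d}$, where $\{k_1,\dots,k_d\}$ runs over the edges of $\mathrm{K}_V^{\mathbf t}$. An ideal $I\subset S$ is normally torsion-free if $\mathrm{Ass}(S/I^k)\subseteq\mathrm{Ass}(S/I)$ for all $k\ge 1$. An ideal $I$ is normal if all powers $I^k$, $k\ge 1$, are integrally closed. *)

theory Defs
  imports
    "HOL-Algebra.Ideal_Product"
    "HOL-Algebra.QuotRing"
    "HOL-Library.Disjoint_Sets"
    "HOL-Library.Poly_Mapping"
begin

section \<open>The polynomial ring in finitely many variables\<close>

text \<open>
  A polynomial is a finitely supported map from exponent vectors to coefficients. The ring
  \<open>mpoly_ring n\<close> is \<open>K[x\<^sub>1, \<dots>, x\<^sub>n]\<close>: its carrier consists of
  the polynomials that involve only variables with index in \<open>{1..n}\<close>.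
\<close>

type_synonym 'k mpol = "(nat \<Rightarrow>\<^sub>0 nat) \<Rightarrow>\<^sub>0 'k"

definition mpoly_ring :: "nat \<Rightarrow> 'k::field mpol ring" where
  "mpoly_ring n =
    \<lparr>carrier = {p. \<forall>a \<in> Poly_Mapping.keys p. Poly_Mapping.keys a \<subseteq> {1..n}},
     mult = (*), one = 1, zero = 0, add = (+)\<rparr>"

definition mpoly_var :: "nat \<Rightarrow> 'k::field mpol" where
  "mpoly_var k = Poly_Mapping.single (Poly_Mapping.single k 1) 1"

lemma cring_mpoly_ring: "cring (mpoly_ring n :: 'k::field mpol ring)"
proof (rule cringI)
  show "abelian_group (mpoly_ring n :: 'k mpol ring)"
  proof (rule abelian_groupI)
    fix x :: "'k mpol"
    assume "x \<in> carrier (mpoly_ring n)"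
    then show "\<exists>y \<in> carrier (mpoly_ring n). y \<oplus>\<^bsub>mpoly_ring n\<^esub> x = \<zero>\<^bsub>mpoly_ring n\<^esub>"
      by (intro bexI[of _ "- x"]) (auto simp: mpoly_ring_def)
  next
    fix x y :: "'k mpol"
    assume "x \<in> carrier (mpoly_ring n)" "y \<in> carrier (mpoly_ring n)"
    then show "x \<oplus>\<^bsub>mpoly_ring n\<^esub> y \<in> carrier (mpoly_ring n)"
      using Poly_Mapping.keys_add[of x y] by (auto simp: mpoly_ring_def)
  qed (auto simp: mpoly_ring_def algebra_simps)
  show "comm_monoid (mpoly_ring n :: 'k mpol ring)"
  proof (rule comm_monoidI)
    fix x y :: "'k mpol"
    assume xy: "x \<in> carrier (mpoly_ring n)" "y \<in> carrier (mpoly_ring n)"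
    have "Poly_Mapping.keys c \<subseteq> {1..n}" if cxy: "c \<in> Poly_Mapping.keys (x * y)" for c
    proof -
      obtain a b where c: "c = a + b"
        and ab: "a \<in> Poly_Mapping.keys x" "b \<in> Poly_Mapping.keys y"
        using cxy Poly_Mapping.keys_mult[of x y] by blast
      have "Poly_Mapping.keys a \<subseteq> {1..n}" "Poly_Mapping.keys b \<subseteq> {1..n}"
        using xy ab by (auto simp: mpoly_ring_def)
      then show ?thesis
        using Poly_Mapping.keys_add[of a b] unfolding c by blast
    qed
    then show "x \<otimes>\<^bsub>mpoly_ring n\<^esub> y \<in> carrier (mpoly_ring n)"
      by (simp add: mpoly_ring_def)
  qed (auto simp: mpoly_ring_def mult.assoc mult.commute)
qed (simp add: mpoly_ring_def distrib_right)


section \<open>Associated primes, integral closure and powers of ideals\<close>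

text \<open>
  The associated primes of the \<open>R\<close>-module \<open>R/I\<close>: the prime ideals that are the
  annihilator of some element of \<open>R/I\<close>. An element \<open>r\<close> of \<open>R\<close> acts on
  \<open>R/I\<close> as multiplication by its coset \<open>I + r\<close>.
\<close>

definition ass_quot :: "('a, 'b) ring_scheme \<Rightarrow> 'a set \<Rightarrow> 'a set set" where
  "ass_quot R I = {P. primeideal P R \<and>
     (\<exists>x \<in> carrier (R Quot I).
        P = {r \<in> carrier R. (I +>\<^bsub>R\<^esub> r) \<otimes>\<^bsub>R Quot I\<^esub> x = \<zero>\<^bsub>R Quot I\<^esub>})}"

text \<open>
  The record \<^const>\<open>ideals_set\<close> carries the product of ideals as its multiplication and
  \<open>R\<close> as its unit, so its powers are the usual powers of ideals.
\<close>

abbreviation ideal_pow :: "('a, 'b) ring_scheme \<Rightarrow> 'a set \<Rightarrow> nat \<Rightarrow> 'a set" where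
  "ideal_pow R I k \<equiv> I [^]\<^bsub>ideals_set R\<^esub> k"

definition normally_torsion_free :: "('a, 'b) ring_scheme \<Rightarrow> 'a set \<Rightarrow> bool" where
  "normally_torsion_free R I \<longleftrightarrow> (\<forall>k \<ge> 1. ass_quot R (ideal_pow R I k) \<subseteq> ass_quot R I)"

definition integral_closure :: "('a, 'b) ring_scheme \<Rightarrow> 'a set \<Rightarrow> 'a set" where
  "integral_closure R I = {f \<in> carrier R. \<exists>m \<ge> 1. \<exists>a.
     (\<forall>i \<in> {1..m}. a i \<in> ideal_pow R I i) \<and>
     f [^]\<^bsub>R\<^esub> m \<oplus>\<^bsub>R\<^esub> (\<Oplus>\<^bsub>R\<^esub>i \<in> {1..m}. a i \<otimes>\<^bsub>R\<^esub> f [^]\<^bsub>R\<^esub> (m - i)) = \<zero>\<^bsub>R\<^esub>}"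

definition integrally_closed :: "('a, 'b) ring_scheme \<Rightarrow> 'a set \<Rightarrow> bool" where
  "integrally_closed R I \<longleftrightarrow> integral_closure R I = I"

definition normal_ideal :: "('a, 'b) ring_scheme \<Rightarrow> 'a set \<Rightarrow> bool" where
  "normal_ideal R I \<longleftrightarrow> (\<forall>k \<ge> 1. integrally_closed R (ideal_pow R I k))"


section \<open>Complete t-spread d-partite hypergraphs and edge ideals\<close>

record 'v hypergraph =
  hverts :: "'v set"
  hedges :: "'v set set"

definition no_isolated_vertices :: "'v hypergraph \<Rightarrow> bool" where
  "no_isolated_vertices H \<longleftrightarrow> (\<forall>v \<in> hverts H. \<exists>e \<in> hedges H. v \<in> e)"

definition edge_ideal :: "nat \<Rightarrow> nat hypergraph \<Rightarrow> 'k::field mpol set" where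
  "edge_ideal n H = Idl\<^bsub>mpoly_ring n\<^esub> {(\<Prod>k \<in> e. mpoly_var k) | e. e \<in> hedges H}"

text \<open>The family \<open>V\<^sub>1, \<dots>, V\<^sub>d\<close> is given by the values of \<open>V\<close> on \<open>{1..d}\<close>.\<close>

definition ordered_family :: "nat \<Rightarrow> nat \<Rightarrow> (nat \<Rightarrow> nat set) \<Rightarrow> bool" where
  "ordered_family n d V \<longleftrightarrow>
     (\<forall>j \<in> {1..d}. V j \<noteq> {} \<and> V j \<subseteq> {1..n}) \<and>
     disjoint_family_on V {1..d} \<and>
     (\<forall>i \<in> {1..d}. \<forall>j \<in> {1..d}. i < j \<longrightarrow> (\<forall>p \<in> V i. \<forall>q \<in> V j. p < q))"

definition spread_edges :: "nat \<Rightarrow> (nat \<Rightarrow> int) \<Rightarrow> (nat \<Rightarrow> nat set) \<Rightarrow> nat set set" where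
  "spread_edges d t V = {k ` {1..d} | k.
     (\<forall>j \<in> {1..d}. k j \<in> V j) \<and>
     (\<forall>j \<in> {2..d}. int (k j) - int (k (j - 1)) \<ge> t (j - 1))}"

definition complete_spread_hypergraph ::
    "nat \<Rightarrow> (nat \<Rightarrow> int) \<Rightarrow> (nat \<Rightarrow> nat set) \<Rightarrow> nat hypergraph" where
  "complete_spread_hypergraph d t V =
     \<lparr>hverts = (\<Union>j \<in> {1..d}. V j), hedges = spread_edges d t V\<rparr>"

end

theory Submission
  imports Defs
begin

text \<open>
  A \<open>t\<close>-spread edge is a path that picks one vertex from each of the ordered layers
  \<open>V 1, \<dots>, V d\<close>, leaving a prescribed gap between consecutive vertices. A cover is a set of
  vertices that meets every edge. The theorem rests on a version of Menger's theorem: if every cover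
  has \<open>a\<close>-weight at least \<open>k\<close>, then \<open>k\<close> edges can be chosen so that each vertex
  \<open>v\<close> lies on at most \<open>a v\<close> of them. As reachability in the next layer is governed by a
  single threshold, the packing can be written down explicitly from the weights of partial cuts
  (\<open>min_cut\<close>, \<open>layered_menger\<close>, \<open>mengerian_complete_spread_hypergraph\<close>).

  For monomials this says that \<open>x\<^sup>a\<close> lies in \<open>I\<^sup>k\<close> if and only if \<open>a\<close> has weight at
  least \<open>k\<close> on every cover \<open>C\<close>. Thus \<open>I\<^sup>k\<close> is the intersection of the powers
  \<open>P\<^sub>C\<^sup>k\<close>, where \<open>P\<^sub>C\<close> is the prime ideal generated by the variables in \<open>C\<close>
  (\<open>mengerian_edge_ideal_pow\<close>). Membership in \<open>P\<^sub>C\<^sup>k\<close> means that a valuation, the least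
  \<open>C\<close>-weight of a monomial, is at least \<open>k\<close> (\<open>cover_order_mult\<close>).

  Both conclusions follow from this description and hold for every hypergraph with the packing property.
  A prime of the form \<open>(I\<^sup>k : f)\<close> is squeezed between ideals attached to one cover, so it is
  \<open>P\<^sub>C\<close> for a minimal cover \<open>C\<close>, and these primes are associated to \<open>I\<close>
  (\<open>mengerian_normally_torsion_free\<close>). An ideal cut out by lower bounds on valuations is
  integrally closed (\<open>mengerian_normal_ideal\<close>).
\<close>

section \<open>Packing paths through ordered layers\<close>

text \<open>
  The layers are \<open>W 0, W 1, \<dots>\<close>, and a path is a sequence \<open>p j \<in> W j\<close> with gaps
  \<open>p j + s j \<le> p (Suc j)\<close>. For disjoint layers, the potential \<open>min_cut W s a j y\<close> is
  the least \<open>a\<close>-weight of a vertex set that meets every path ending in layer \<open>j\<close> strictly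
  below \<open>y\<close>. The recursion chooses a threshold \<open>r\<close> for layer \<open>j\<close>: after all paths arriving below \<open>r\<close>
  are cut, layer \<open>Suc j\<close> can be entered only from \<open>r + s j\<close> on, so it remains to remove the
  vertices between \<open>r + s j\<close> and \<open>y\<close>.
\<close>

primrec min_cut ::
    "(nat \<Rightarrow> nat set) \<Rightarrow> (nat \<Rightarrow> nat) \<Rightarrow> (nat \<Rightarrow> nat) \<Rightarrow> nat \<Rightarrow> nat \<Rightarrow> nat" where
  "min_cut W s a 0 y = sum a (W 0 \<inter> {..<y})"
| "min_cut W s a (Suc j) y =
     (INF r. min_cut W s a j r + sum a (W (Suc j) \<inter> {r + s j..<y}))"

lemma min_cut_Suc_le:
  "min_cut W s a (Suc j) y \<le> min_cut W s a j r + sum a (W (Suc j) \<inter> {r + s j..<y})"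
  by (auto intro!: cINF_lower)

lemma min_cut_Suc_attained:
  obtains r where
    "min_cut W s a (Suc j) y = min_cut W s a j r + sum a (W (Suc j) \<inter> {r + s j..<y})"
proof -
  have "min_cut W s a (Suc j) y \<in>
      range (\<lambda>r. min_cut W s a j r + sum a (W (Suc j) \<inter> {r + s j..<y}))"
    unfolding min_cut.simps by (rule Inf_nat_def1) simp
  then show ?thesis
    using that by blast
qed

text \<open>
  Taking the threshold \<open>r\<close> itself leaves nothing to remove in the next layer. This inequality
  is what makes consecutive vertices of the packed paths respect the gaps.
\<close>

lemma min_cut_spread: "min_cut W s a (Suc j) (r + s j) \<le> min_cut W s a j r"
  using min_cut_Suc_le[of W s a j "r + s j" r] by simp

lemma min_cut_layer_antimono: "min_cut W s a (Suc j) y \<le> min_cut W s a j y"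
  using min_cut_Suc_le[of W s a j y y] by simp

lemma min_cut_0 [simp]: "min_cut W s a j 0 = 0"
proof (induction j)
  case (Suc j)
  then show ?case using min_cut_layer_antimono[of W s a j 0] by simp
qed simp

lemma min_cut_mono:
  assumes "y \<le> y'"
  shows "min_cut W s a j y \<le> min_cut W s a j y'"
proof (cases j)
  case 0
  then show ?thesis using assms by (auto intro!: sum_mono2)
next
  case (Suc i)
  obtain r where r: "min_cut W s a (Suc i) y' =
      min_cut W s a i r + sum a (W (Suc i) \<inter> {r + s i..<y'})"
    by (rule min_cut_Suc_attained)
  have "sum a (W (Suc i) \<inter> {r + s i..<y}) \<le> sum a (W (Suc i) \<inter> {r + s i..<y'})"
    using assms by (intro sum_mono2) auto
  then show ?thesis
    using min_cut_Suc_le[of W s a i y r] r Suc by simp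
qed

text \<open>
  The growth of the potential at \<open>y\<close> is bounded by the capacity of \<open>y\<close>, because an optimal
  threshold for \<open>y\<close> is still admissible for \<open>Suc y\<close>. It bounds the number of packed
  paths through \<open>y\<close> and keeps them inside the layer.
\<close>

lemma min_cut_step:
  "min_cut W s a j (Suc y) \<le> min_cut W s a j y + (if y \<in> W j then a y else 0)"
proof -
  have step: "sum a (A \<inter> {..<Suc y} - B) \<le> sum a (A \<inter> {..<y} - B) + (if y \<in> A then a y else 0)"
    for A B
  proof -
    have "sum a (A \<inter> {..<Suc y} - B) \<le> sum a ((A \<inter> {..<y} - B) \<union> (A \<inter> {y}))"
      by (rule sum_mono2) (auto simp: less_Suc_eq)
    also have "\<dots> \<le> sum a (A \<inter> {..<y} - B) + sum a (A \<inter> {y})"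
      using sum_Un_nat[of "A \<inter> {..<y} - B" "A \<inter> {y}" a] by simp
    also have "sum a (A \<inter> {y}) = (if y \<in> A then a y else 0)"
      by auto
    finally show ?thesis .
  qed
  show ?thesis
  proof (cases j)
    case 0
    then show ?thesis using step[of "W 0" "{}"] by simp
  next
    case (Suc i)
    obtain r where r: "min_cut W s a (Suc i) y =
        min_cut W s a i r + sum a (W (Suc i) \<inter> {r + s i..<y})"
      by (rule min_cut_Suc_attained)
    have "W (Suc i) \<inter> {r + s i..<z} = W (Suc i) \<inter> {..<z} - {..<r + s i}" for z
      by auto
    then show ?thesis
      using step[of "W (Suc i)" "{..<r + s i}"] min_cut_Suc_le[of W s a i "Suc y" r] r Suc
      by simp
  qed
qed

text \<open>
  A union of the intervals removed by optimal thresholds is a genuine cut: a path that avoids them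
  stays above every threshold. Overlaps between the intervals only make the union lighter, which is why
  the weights are compared by an inequality.
\<close>

lemma min_cut_realised:
  obtains C where "finite C" "C \<subseteq> (\<Union>l\<le>j. W l)" "sum a C \<le> min_cut W s a j y"
    and "\<And>p. (\<And>l. l \<le> j \<Longrightarrow> p l \<in> W l - C) \<Longrightarrow> (\<And>l. l < j \<Longrightarrow> p l + s l \<le> p (Suc l)) \<Longrightarrow> y \<le> p j"
proof (induction j arbitrary: y thesis)
  case 0
  show ?case
  proof (rule 0[of "W 0 \<inter> {..<y}"])
    fix p assume "\<And>l. l \<le> 0 \<Longrightarrow> p l \<in> W l - W 0 \<inter> {..<y}"
    from this[of 0] show "y \<le> p 0" by auto
  qed auto
next
  case (Suc j)
  obtain r where r: "min_cut W s a (Suc j) y =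
      min_cut W s a j r + sum a (W (Suc j) \<inter> {r + s j..<y})"
    by (rule min_cut_Suc_attained)
  obtain C where C: "finite C" "C \<subseteq> (\<Union>l\<le>j. W l)" "sum a C \<le> min_cut W s a j r"
    and cut: "\<And>p. (\<And>l. l \<le> j \<Longrightarrow> p l \<in> W l - C) \<Longrightarrow> (\<And>l. l < j \<Longrightarrow> p l + s l \<le> p (Suc l)) \<Longrightarrow> r \<le> p j"
    by (rule Suc.IH[where y = r]) blast
  let ?D = "W (Suc j) \<inter> {r + s j..<y}"
  show ?case
  proof (rule Suc.prems[of "C \<union> ?D"])
    show "C \<union> ?D \<subseteq> (\<Union>l\<le>Suc j. W l)"
      using C(2) by (fastforce simp: atMost_Suc)
    show "sum a (C \<union> ?D) \<le> min_cut W s a (Suc j) y"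
      using sum_Un_nat[of C ?D a] C(1,3) r by simp
    fix p assume p: "\<And>l. l \<le> Suc j \<Longrightarrow> p l \<in> W l - (C \<union> ?D)"
      "\<And>l. l < Suc j \<Longrightarrow> p l + s l \<le> p (Suc l)"
    have "r \<le> p j"
      using p by (intro cut) auto
    then have "r + s j \<le> p (Suc j)"
      using p(2)[of j] by simp
    then show "y \<le> p (Suc j)"
      using p(1)[of "Suc j"] by (auto simp: not_less)
  qed (use C(1) in simp)
qed

text \<open>
  The paths are read off the potentials. Path number \<open>i\<close> (counted from \<open>0\<close>) visits in
  layer \<open>j\<close> the point \<open>y\<close> at which the potential jumps past \<open>i\<close>, that is,
  \<open>min_cut W s a j y \<le> i < min_cut W s a j (Suc y)\<close>. Hence the paths through \<open>y\<close> are
  numbered by an interval of length at most \<open>a y\<close>, and the jump points respect the gaps because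
  the potential of the next layer, shifted by the gap, is no larger.
\<close>

lemma layered_menger:
  fixes W :: "nat \<Rightarrow> nat set" and s a :: "nat \<Rightarrow> nat"
  assumes bounded: "\<And>j. j \<le> d \<Longrightarrow> W j \<subseteq> {..<N}"
    and cuts: "\<And>C. C \<subseteq> (\<Union>j\<le>d. W j) \<Longrightarrow>
      (\<And>p. (\<And>j. j \<le> d \<Longrightarrow> p j \<in> W j) \<Longrightarrow> (\<And>j. j < d \<Longrightarrow> p j + s j \<le> p (Suc j)) \<Longrightarrow>
        \<exists>j\<le>d. p j \<in> C) \<Longrightarrow> k \<le> sum a C"
  shows "\<exists>p. (\<forall>i<k. (\<forall>j\<le>d. p i j \<in> W j) \<and> (\<forall>j<d. p i j + s j \<le> p i (Suc j))) \<and>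
    (\<forall>j\<le>d. \<forall>v. card {i. i < k \<and> p i j = v} \<le> a v)"
proof -
  let ?f = "min_cut W s a"
  have "k \<le> ?f d N"
  proof -
    obtain C where C: "C \<subseteq> (\<Union>l\<le>d. W l)" "sum a C \<le> ?f d N"
      and cut: "\<And>p. (\<And>l. l \<le> d \<Longrightarrow> p l \<in> W l - C) \<Longrightarrow> (\<And>l. l < d \<Longrightarrow> p l + s l \<le> p (Suc l)) \<Longrightarrow> N \<le> p d"
      by (rule min_cut_realised[where W = W and s = s and a = a and j = d and y = N]) blast
    have "k \<le> sum a C"
    proof (rule cuts[OF C(1)])
      fix p assume p: "\<And>j. j \<le> d \<Longrightarrow> p j \<in> W j" "\<And>j. j < d \<Longrightarrow> p j + s j \<le> p (Suc j)"
      show "\<exists>j\<le>d. p j \<in> C"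
      proof (rule ccontr)
        assume "\<not> ?thesis"
        then have "N \<le> p d"
          using p by (intro cut) auto
        then show False
          using p(1)[of d] bounded[of d] by auto
      qed
    qed
    with C(2) show ?thesis by simp
  qed
  moreover have "?f d N \<le> ?f j N" if "j \<le> d" for j
    by (rule lift_Suc_antimono_le[of "\<lambda>j. ?f j N", OF min_cut_layer_antimono that])
  ultimately have large: "k \<le> ?f j N" if "j \<le> d" for j
    using that order_trans by blast
  \<comment> \<open>The bound \<open>large\<close> guarantees that the jump exists for every \<open>i < k\<close>.\<close>
  define p where "p i j = (LEAST y. i < ?f j (Suc y))" for i j
  have above: "i < ?f j (Suc (p i j))" if "i < k" "j \<le> d" for i j
  proof -
    have "N \<noteq> 0" using large[OF that(2)] that(1) by (cases N) auto
    then have "i < ?f j (Suc (N - 1))"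
      using large[OF that(2)] that(1) by simp
    then show ?thesis unfolding p_def by (rule LeastI)
  qed
  have below: "?f j (p i j) \<le> i" for i j
  proof (cases "p i j")
    case (Suc y)
    then show ?thesis
      using not_less_Least[of y "\<lambda>y. i < ?f j (Suc y)"] by (simp add: p_def)
  qed simp
  have in_layer: "p i j \<in> W j" if "i < k" "j \<le> d" for i j
    using min_cut_step[of W s a j "p i j"] above[OF that] below[of j i] by (auto split: if_splits)
  show ?thesis
  proof (intro exI[of _ p] conjI allI impI)
    fix i j assume ij: "i < k" "j < d"
    have "?f (Suc j) (p i j + s j) < ?f (Suc j) (Suc (p i (Suc j)))"
      using min_cut_spread[of W s a j "p i j"] below[of j i] above[of i "Suc j"] ij by simp
    then show "p i j + s j \<le> p i (Suc j)"
      using min_cut_mono[of "Suc (p i (Suc j))" "p i j + s j" W s a "Suc j"]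
      by (meson not_le not_less_eq_eq)
  next
    fix j v assume j: "j \<le> d"
    show "card {i. i < k \<and> p i j = v} \<le> a v"
    proof (cases "v \<in> W j")
      case True
      have "{i. i < k \<and> p i j = v} \<subseteq> {?f j v..<?f j (Suc v)}"
        using above below j by auto
      then have "card {i. i < k \<and> p i j = v} \<le> ?f j (Suc v) - ?f j v"
        using card_mono[of "{?f j v..<?f j (Suc v)}"] by fastforce
      then show ?thesis
        using min_cut_step[of W s a j v] True by simp
    next
      case False
      then have none: "{i. i < k \<and> p i j = v} = {}"
        using in_layer j by blast
      show ?thesis unfolding none by simp
    qed
  qed (use in_layer in auto)
qed

section \<open>The max-flow min-cut property of spread hypergraphs\<close>

definition covers :: "nat \<Rightarrow> nat hypergraph \<Rightarrow> nat set set" where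
  "covers n H = {C. C \<subseteq> {1..n} \<and> (\<forall>e \<in> hedges H. C \<inter> e \<noteq> {})}"

text \<open>
  The integral max-flow min-cut property of a clutter: for every vector of capacities, as many edges
  can be packed as the lightest cover allows.
\<close>

definition mengerian :: "nat \<Rightarrow> nat hypergraph \<Rightarrow> bool" where
  "mengerian n H \<longleftrightarrow> (\<forall>(a :: nat \<Rightarrow> nat) k. (\<forall>C \<in> covers n H. k \<le> sum a C) \<longrightarrow>
     (\<exists>e. (\<forall>i<k. e i \<in> hedges H) \<and> (\<forall>v. card {i. i < k \<and> v \<in> e i} \<le> a v)))"

lemma edge_subset_vertices:
  assumes "ordered_family n d V" "e \<in> hedges (complete_spread_hypergraph d t V)"
  shows "e \<subseteq> {1..n}"
  using assms by (fastforce simp: complete_spread_hypergraph_def spread_edges_def ordered_family_def)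

text \<open>
  A \<open>t\<close>-spread edge is a path through the layers \<open>V 1, \<dots>, V d\<close>. Since the
  \<open>V j\<close> are disjoint, a vertex can be used by an edge in one layer only, so the layerwise
  capacity bounds are bounds for the edges.
\<close>

lemma mengerian_complete_spread_hypergraph:
  assumes "d \<ge> 1" and t: "\<forall>j \<in> {1..d - 1}. t j \<ge> 1" and V: "ordered_family n d V"
  shows "mengerian n (complete_spread_hypergraph d t V)"
  unfolding mengerian_def
proof (intro allI impI)
  let ?H = "complete_spread_hypergraph d t V"
  fix a :: "nat \<Rightarrow> nat" and k
  assume a: "\<forall>C \<in> covers n ?H. k \<le> sum a C"
  obtain d' where d: "d = Suc d'"
    using \<open>d \<ge> 1\<close> by (cases d) auto
  \<comment> \<open>The layers and gaps of \<open>layered_menger\<close> are indexed from \<open>0\<close>.\<close>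
  define W where "W j = V (Suc j)" for j
  define s where "s j = nat (t (Suc j))" for j
  have sub: "W j \<subseteq> {1..n}" if "j \<le> d'" for j
    using V that by (auto simp: ordered_family_def W_def d)
  have edgeI: "p ` {..d'} \<in> hedges ?H"
    if p: "\<And>j. j \<le> d' \<Longrightarrow> p j \<in> W j" "\<And>j. j < d' \<Longrightarrow> p j + s j \<le> p (Suc j)" for p
  proof -
    have "(\<lambda>j. p (j - 1)) ` {1..d} = p ` {..d'}"
    proof -
      have "{..d'} = (\<lambda>j. j - 1) ` {1..d}"
        by (force simp: d image_iff intro: bexI[of _ "Suc _"])
      then show ?thesis by (simp add: image_image)
    qed
    moreover have "p (j - 1) \<in> V j" if "j \<in> {1..d}" for j
      using p(1)[of "j - 1"] that by (auto simp: W_def d)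
    moreover have "int (p (j - 1)) - int (p (j - 1 - 1)) \<ge> t (j - 1)" if "j \<in> {2..d}" for j
    proof -
      have j: "j - 2 < d'" "Suc (j - 2) = j - 1" "j - 1 - 1 = j - 2"
        using that by (auto simp: d)
      have "int (p (j - 2)) + int (s (j - 2)) \<le> int (p (j - 1))"
        using p(2)[OF j(1)] unfolding j(2) by linarith
      moreover have "t (j - 1) \<le> int (s (j - 2))"
        unfolding s_def j(2) by simp
      ultimately show ?thesis
        unfolding j(3) by linarith
    qed
    ultimately show ?thesis
      unfolding complete_spread_hypergraph_def spread_edges_def hypergraph.simps
      by (intro CollectI exI[of _ "\<lambda>j. p (j - 1)"]) auto
  qed
  have "\<exists>p. (\<forall>i<k. (\<forall>j\<le>d'. p i j \<in> W j) \<and> (\<forall>j<d'. p i j + s j \<le> p i (Suc j))) \<and>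
    (\<forall>j\<le>d'. \<forall>v. card {i. i < k \<and> p i j = v} \<le> a v)"
  proof (rule layered_menger)
    show "W j \<subseteq> {..<Suc n}" if "j \<le> d'" for j
      using sub[OF that] by auto
  next
    fix C assume C: "C \<subseteq> (\<Union>j\<le>d'. W j)"
      and cut: "\<And>p. (\<And>j. j \<le> d' \<Longrightarrow> p j \<in> W j) \<Longrightarrow> (\<And>j. j < d' \<Longrightarrow> p j + s j \<le> p (Suc j)) \<Longrightarrow>
        \<exists>j\<le>d'. p j \<in> C"
    have "C \<inter> e \<noteq> {}" if e_edge: "e \<in> hedges ?H" for e
    proof -
      obtain q where e: "e = q ` {1..d}" and q: "\<forall>j \<in> {1..d}. q j \<in> V j"
        "\<forall>j \<in> {2..d}. int (q j) - int (q (j - 1)) \<ge> t (j - 1)"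
        using e_edge unfolding complete_spread_hypergraph_def spread_edges_def hypergraph.simps by blast
      have "\<exists>j\<le>d'. q (Suc j) \<in> C"
      proof (rule cut)
        fix j assume "j \<le> d'"
        then show "q (Suc j) \<in> W j" using q(1) by (simp add: W_def d)
      next
        fix j assume "j < d'"
        then show "q (Suc j) + s j \<le> q (Suc (Suc j))"
          using q(2)[rule_format, of "Suc (Suc j)"] t[rule_format, of "Suc j"]
          by (simp add: s_def d)
      qed
      then show ?thesis by (auto simp: e d)
    qed
    moreover have "C \<subseteq> {1..n}"
      using C sub by blast
    ultimately show "k \<le> sum a C"
      using a by (simp add: covers_def)
  qed
  then obtain p
    where layers_gaps: "\<forall>i<k. (\<forall>j\<le>d'. p i j \<in> W j) \<and> (\<forall>j<d'. p i j + s j \<le> p i (Suc j))"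
      and load: "\<forall>j\<le>d'. \<forall>v. card {i. i < k \<and> p i j = v} \<le> a v"
    by (elim exE conjE) (rule that)
  have p: "p i j \<in> W j" if "i < k" "j \<le> d'" for i j
    using layers_gaps that by simp
  have packed: "card {i. i < k \<and> v \<in> p i ` {..d'}} \<le> a v" for v
  proof (cases "\<exists>j\<le>d'. v \<in> W j")
    case True
    then obtain j where j: "j \<le> d'" "v \<in> W j" by blast
    have "l = j" if "l \<le> d'" "v \<in> W l" for l
    proof -
      have "disjoint_family_on V {1..d}"
        using V by (simp add: ordered_family_def)
      then show ?thesis
        using disjoint_family_onD[of V "{1..d}" "Suc l" "Suc j"] that j
        by (auto simp: W_def d)
    qed
    then have "{i. i < k \<and> v \<in> p i ` {..d'}} = {i. i < k \<and> p i j = v}"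
      using p j by blast
    then show ?thesis using load j(1) by simp
  next
    case False
    then have none: "{i. i < k \<and> v \<in> p i ` {..d'}} = {}"
      using p by blast
    show ?thesis unfolding none by simp
  qed
  show "\<exists>e. (\<forall>i<k. e i \<in> hedges ?H) \<and> (\<forall>v. card {i. i < k \<and> v \<in> e i} \<le> a v)"
  proof (rule exI[of _ "\<lambda>i. p i ` {..d'}"], intro conjI allI impI)
    fix i assume "i < k"
    then show "p i ` {..d'} \<in> hedges ?H"
      by (intro edgeI) (simp_all add: layers_gaps)
  qed (rule packed)
qed

section \<open>The polynomial ring\<close>

lemma mpoly_ring_simps [simp]:
  "f \<otimes>\<^bsub>mpoly_ring n\<^esub> g = f * g" "f \<oplus>\<^bsub>mpoly_ring n\<^esub> g = f + g"
  "\<one>\<^bsub>mpoly_ring n\<^esub> = 1" "\<zero>\<^bsub>mpoly_ring n\<^esub> = 0"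
  by (simp_all add: mpoly_ring_def)

lemma mpoly_ring_pow [simp]: "f [^]\<^bsub>mpoly_ring n\<^esub> (k :: nat) = f ^ k"
  by (induction k) (simp_all add: mult.commute)

lemma in_mpoly_ring_iff:
  "f \<in> carrier (mpoly_ring n) \<longleftrightarrow> (\<forall>a \<in> Poly_Mapping.keys f. Poly_Mapping.keys a \<subseteq> {1..n})"
  by (simp add: mpoly_ring_def)

lemma mpoly_ring_finsum:
  assumes "finite A" "\<And>x. x \<in> A \<Longrightarrow> g x \<in> carrier (mpoly_ring n :: 'k::field mpol ring)"
  shows "finsum (mpoly_ring n) g A = sum g A"
proof -
  interpret cring "mpoly_ring n :: 'k mpol ring" by (rule cring_mpoly_ring)
  show ?thesis
    using assms
  proof (induction A rule: finite_induct)
    case (insert x A)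
    then show ?case by (subst finsum_insert) auto
  qed (simp add: finsum_empty)
qed

section \<open>Powers of the prime ideals generated by variables\<close>

definition weight :: "nat set \<Rightarrow> (nat \<Rightarrow>\<^sub>0 nat) \<Rightarrow> nat" where
  "weight C a = sum (Poly_Mapping.lookup a) C"

lemma weight_add: "weight C (a + b) = weight C a + weight C b"
  by (simp add: weight_def lookup_add sum.distrib)

text \<open>
  This is the \<open>k\<close>-th power of the prime ideal generated by the variables \<open>x\<^sub>v\<close> with
  \<open>v \<in> C\<close>, described by a condition on monomials, so that membership can be tested termwise.
\<close>

definition cover_power :: "nat \<Rightarrow> nat set \<Rightarrow> nat \<Rightarrow> 'k::field mpol set" where
  "cover_power n C k = {f \<in> carrier (mpoly_ring n). \<forall>a \<in> Poly_Mapping.keys f. k \<le> weight C a}"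

lemma cover_powerD: "f \<in> cover_power n C k \<Longrightarrow> f \<in> carrier (mpoly_ring n)"
  by (simp add: cover_power_def)

lemma cover_power_antimono: "k \<le> l \<Longrightarrow> cover_power n C l \<subseteq> cover_power n C k"
  by (force simp: cover_power_def)

lemma cover_power_0: "cover_power n C 0 = carrier (mpoly_ring n)"
  by (simp add: cover_power_def)

lemma cover_power_mult:
  assumes "f \<in> cover_power n C k" "g \<in> cover_power n C l"
  shows "f * g \<in> cover_power n C (k + l)"
proof -
  interpret cring "mpoly_ring n :: 'a mpol ring" by (rule cring_mpoly_ring)
  have "f * g \<in> carrier (mpoly_ring n)"
    using m_closed[of f g] assms by (simp add: cover_powerD)
  moreover have "k + l \<le> weight C c" if c: "c \<in> Poly_Mapping.keys (f * g)" for c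
  proof -
    obtain a b where "c = a + b" "a \<in> Poly_Mapping.keys f" "b \<in> Poly_Mapping.keys g"
      using c Poly_Mapping.keys_mult[of f g] by blast
    then show ?thesis
      using assms by (simp add: weight_add add_mono cover_power_def)
  qed
  ultimately show ?thesis by (simp add: cover_power_def)
qed

lemma cover_power_power:
  assumes "f \<in> cover_power n C k"
  shows "f ^ m \<in> cover_power n C (m * k)"
proof (induction m)
  case 0
  show ?case by (simp add: cover_power_def in_mpoly_ring_iff)
next
  case (Suc m)
  then show ?case using cover_power_mult[OF assms Suc] by simp
qed

lemma cover_power_add:
  assumes "f \<in> cover_power n C k" "g \<in> cover_power n C k"
  shows "f + g \<in> cover_power n C k"
  using assms Poly_Mapping.keys_add[of f g] unfolding cover_power_def in_mpoly_ring_iff by blast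

lemma cover_power_sum:
  assumes "finite A" "\<And>x. x \<in> A \<Longrightarrow> g x \<in> cover_power n C k"
  shows "sum g A \<in> cover_power n C k"
  using assms
proof (induction A rule: finite_induct)
  case empty
  show ?case by (simp add: cover_power_def in_mpoly_ring_iff)
qed (simp add: cover_power_add)

lemma cover_power_absorb:
  assumes "f \<in> carrier (mpoly_ring n)" "g \<in> cover_power n C k"
  shows "f * g \<in> cover_power n C k"
  using cover_power_mult[of f n C 0 g k] assms by (simp add: cover_power_0)

lemma mpoly_ring_a_inv:
  assumes "f \<in> carrier (mpoly_ring n :: 'k::field mpol ring)"
  shows "\<ominus>\<^bsub>mpoly_ring n\<^esub> f = - f"
proof -
  interpret cring "mpoly_ring n :: 'k mpol ring" by (rule cring_mpoly_ring)
  have "- f \<in> carrier (mpoly_ring n)"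
    using assms by (simp add: in_mpoly_ring_iff in_keys_iff)
  then show ?thesis
    using assms by (intro minus_equality) simp_all
qed

lemma cover_power_uminus:
  "f \<in> cover_power n C k \<Longrightarrow> - f \<in> cover_power n C k"
  by (simp add: cover_power_def in_mpoly_ring_iff in_keys_iff)

lemma ideal_cover_power: "ideal (cover_power n C k) (mpoly_ring n :: 'k::field mpol ring)"
proof -
  interpret cring "mpoly_ring n :: 'k mpol ring" by (rule cring_mpoly_ring)
  show ?thesis
  proof (rule idealI)
    show "subgroup (cover_power n C k) (add_monoid (mpoly_ring n :: 'k mpol ring))"
    proof (rule add.subgroupI)
      show "cover_power n C k \<subseteq> carrier (mpoly_ring n)"
        by (auto simp: cover_powerD)
      have "0 \<in> cover_power n C k"
        by (simp add: cover_power_def in_mpoly_ring_iff)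
      then show "cover_power n C k \<noteq> {}" by blast
    next
      fix f :: "'k mpol" assume f: "f \<in> cover_power n C k"
      then show "\<ominus>\<^bsub>mpoly_ring n\<^esub> f \<in> cover_power n C k"
        by (simp add: mpoly_ring_a_inv cover_power_uminus cover_powerD)
    qed (simp add: cover_power_add)
  next
    fix f g :: "'k mpol" assume "f \<in> cover_power n C k" "g \<in> carrier (mpoly_ring n)"
    then show "g \<otimes>\<^bsub>mpoly_ring n\<^esub> f \<in> cover_power n C k" "f \<otimes>\<^bsub>mpoly_ring n\<^esub> g \<in> cover_power n C k"
      by (simp_all add: cover_power_absorb mult.commute[of f g])
  qed (rule ring_axioms)
qed

section \<open>The valuation attached to a set of variables\<close>

lemma split_keys:
  fixes f :: "'a \<Rightarrow>\<^sub>0 'b::comm_monoid_add"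
  obtains g h where "f = g + h" "Poly_Mapping.keys g = {a \<in> Poly_Mapping.keys f. P a}"
    "Poly_Mapping.keys h = {a \<in> Poly_Mapping.keys f. \<not> P a}"
proof -
  define r where "r Q = Abs_poly_mapping (\<lambda>a. Poly_Mapping.lookup f a when Q a)" for Q
  have r: "Poly_Mapping.lookup (r Q) a = (Poly_Mapping.lookup f a when Q a)" for Q a
    unfolding r_def
    by (subst lookup_Abs_poly_mapping)
      (auto intro: finite_subset[OF _ finite_keys[of f]] simp: in_keys_iff)
  show thesis
  proof (rule that[of "r P" "r (\<lambda>a. \<not> P a)"])
    show "f = r P + r (\<lambda>a. \<not> P a)"
      by (rule poly_mapping_eqI) (simp add: lookup_add r when_def)
  qed (auto simp: in_keys_iff r)
qed

text \<open>
  The order of vanishing along the linear subspace where all variables in \<open>C\<close> vanish; it is only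
  meaningful for \<open>f \<noteq> 0\<close>.
\<close>

definition cover_order :: "nat set \<Rightarrow> 'k::field mpol \<Rightarrow> nat" where
  "cover_order C f = Min (weight C ` Poly_Mapping.keys f)"

lemma mem_cover_power_iff_cover_order:
  assumes "f \<noteq> 0"
  shows "f \<in> cover_power n C k \<longleftrightarrow> f \<in> carrier (mpoly_ring n) \<and> k \<le> cover_order C f"
  using assms by (auto simp: cover_power_def cover_order_def Min_ge_iff)

text \<open>
  The order is a valuation. The product of the two components of lowest weight is nonzero, as polynomials
  over a field have no zero divisors, and all other contributions to \<open>f * g\<close> have larger weight, so
  nothing can cancel it.
\<close>

lemma cover_order_mult:
  fixes f g :: "'k::field mpol"
  assumes "f \<noteq> 0" "g \<noteq> 0"
  shows "cover_order C (f * g) = cover_order C f + cover_order C g"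
proof -
  have cover_order_le: "cover_order C h \<le> weight C a" if "a \<in> Poly_Mapping.keys h" for h :: "'k mpol" and a
    using that by (simp add: cover_order_def)
  have attained: "\<exists>a \<in> Poly_Mapping.keys h. weight C a = cover_order C h" if "h \<noteq> 0" for h :: "'k mpol"
  proof -
    have "cover_order C h \<in> weight C ` Poly_Mapping.keys h"
      unfolding cover_order_def using that by (intro Min_in) (auto simp: keys_eq_empty)
    then show ?thesis by auto
  qed
  obtain f0 f1 where f: "f = f0 + f1"
    and f0: "Poly_Mapping.keys f0 = {a \<in> Poly_Mapping.keys f. weight C a = cover_order C f}"
    and f1: "Poly_Mapping.keys f1 = {a \<in> Poly_Mapping.keys f. \<not> weight C a = cover_order C f}"
    by (rule split_keys)
  obtain g0 g1 where g: "g = g0 + g1"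
    and g0: "Poly_Mapping.keys g0 = {a \<in> Poly_Mapping.keys g. weight C a = cover_order C g}"
    and g1: "Poly_Mapping.keys g1 = {a \<in> Poly_Mapping.keys g. \<not> weight C a = cover_order C g}"
    by (rule split_keys)
  have "f0 \<noteq> 0" "g0 \<noteq> 0"
    using attained[OF assms(1)] attained[OF assms(2)] f0 g0 by auto
  then have "f0 * g0 \<noteq> 0" by simp
  then obtain c where c: "c \<in> Poly_Mapping.keys (f0 * g0)"
    using keys_eq_empty by blast
  have wc: "weight C c = cover_order C f + cover_order C g"
    using c Poly_Mapping.keys_mult[of f0 g0] f0 g0 by (auto simp: weight_add)
  have "c \<notin> Poly_Mapping.keys (f0 * g1)"
    using Poly_Mapping.keys_mult[of f0 g1] f0 g1 wc cover_order_le by (fastforce simp: weight_add)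
  moreover have "c \<notin> Poly_Mapping.keys (f1 * g)"
  proof
    assume "c \<in> Poly_Mapping.keys (f1 * g)"
    then obtain a b where "c = a + b" "a \<in> Poly_Mapping.keys f1" "b \<in> Poly_Mapping.keys g"
      using Poly_Mapping.keys_mult[of f1 g] by blast
    then show False
      using cover_order_le[of a f] cover_order_le[of b g] f1 wc by (auto simp: weight_add)
  qed
  moreover have "f * g = f0 * g0 + f0 * g1 + f1 * g"
    by (simp add: f g algebra_simps)
  ultimately have cfg: "c \<in> Poly_Mapping.keys (f * g)"
    using c by (simp add: in_keys_iff lookup_add)
  have lower: "cover_order C f + cover_order C g \<le> weight C a" if "a \<in> Poly_Mapping.keys (f * g)" for a
  proof -
    obtain x y where "a = x + y" "x \<in> Poly_Mapping.keys f" "y \<in> Poly_Mapping.keys g"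
      using Poly_Mapping.keys_mult[of f g] \<open>a \<in> _\<close> by blast
    then show ?thesis
      using cover_order_le by (simp add: weight_add add_mono)
  qed
  show ?thesis
    unfolding cover_order_def[of C "f * g"]
    using cfg wc lower by (intro Min_eqI) (auto intro: rev_image_eqI)
qed

lemma cover_order_power:
  assumes "f \<noteq> 0"
  shows "cover_order C (f ^ m) = m * cover_order C f"
proof (induction m)
  case 0
  show ?case by (simp add: cover_order_def weight_def)
next
  case (Suc m)
  then show ?case using assms by (simp add: cover_order_mult)
qed

text \<open>
  A consequence of the additivity of the order: a factor that lifts \<open>f\<close> into the ideal must itself
  have positive order.
\<close>

lemma cover_power_colon:
  assumes "r \<in> carrier (mpoly_ring n)" "f \<in> carrier (mpoly_ring n)"
    and "f \<notin> cover_power n C k" "r * f \<in> cover_power n C k"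
  shows "r \<in> cover_power n C 1"
proof (cases "r = 0")
  case False
  have "f \<noteq> 0"
    using assms by auto
  then show ?thesis
    using assms False by (auto simp: mem_cover_power_iff_cover_order cover_order_mult)
qed (simp add: cover_power_def in_mpoly_ring_iff)

section \<open>Monomials\<close>

lemma mpoly_eq_sum_monomials:
  "f = (\<Sum>a \<in> Poly_Mapping.keys f. Poly_Mapping.single a (Poly_Mapping.lookup f a))"
  by (rule poly_mapping_eqI)
    (auto simp: lookup_sum lookup_single when_def in_keys_iff)

definition indicator_monomial :: "nat set \<Rightarrow> (nat \<Rightarrow>\<^sub>0 nat)" where
  "indicator_monomial A = (\<Sum>v \<in> A. Poly_Mapping.single v 1)"

lemma lookup_indicator_monomial:
  "finite A \<Longrightarrow> Poly_Mapping.lookup (indicator_monomial A) v = (if v \<in> A then 1 else 0)"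
  by (auto simp: indicator_monomial_def lookup_sum lookup_single when_def)

lemma prod_var_eq_single:
  "(\<Prod>v \<in> A. mpoly_var v) = (Poly_Mapping.single (indicator_monomial A) 1 :: 'k::field mpol)"
proof (cases "finite A")
  case True
  then show ?thesis
  proof (induction A rule: finite_induct)
    case (insert v A)
    then show ?case
      by (simp add: indicator_monomial_def mpoly_var_def mult_single)
  qed (simp add: indicator_monomial_def)
qed (simp add: indicator_monomial_def)

lemma prod_var_in_carrier:
  assumes "A \<subseteq> {1..n}"
  shows "(\<Prod>v \<in> A. mpoly_var v) \<in> carrier (mpoly_ring n :: 'k::field mpol ring)"
  using assms finite_subset[OF assms]
  by (auto simp: prod_var_eq_single in_mpoly_ring_iff in_keys_iff lookup_indicator_monomial split: if_splits)

lemma prod_var_in_cover_power_iff: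
  assumes "A \<subseteq> {1..n}" "C \<subseteq> {1..n}"
  shows "(\<Prod>v \<in> A. mpoly_var v) \<in> (cover_power n C 1 :: 'k::field mpol set) \<longleftrightarrow> C \<inter> A \<noteq> {}"
proof -
  have "finite A" "finite C"
    using assms finite_subset by auto
  then show ?thesis
    using prod_var_in_carrier[OF assms(1), where 'k = 'k]
    by (auto simp: cover_power_def weight_def prod_var_eq_single lookup_indicator_monomial Suc_le_eq
        sum_nonneg_eq_0_iff simp flip: neq0_conv split: if_splits)
qed

lemma ideal_mem_if_monomials_mem:
  fixes f :: "'k::field mpol"
  assumes "ideal J (mpoly_ring n)"
    and monomials: "\<And>a. a \<in> Poly_Mapping.keys f \<Longrightarrow> Poly_Mapping.single a (Poly_Mapping.lookup f a) \<in> J"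
  shows "f \<in> J"
proof -
  interpret J: ideal J "mpoly_ring n" by (rule assms(1))
  have "(\<Sum>a \<in> B. Poly_Mapping.single a (Poly_Mapping.lookup f a)) \<in> J"
    if "finite B" "B \<subseteq> Poly_Mapping.keys f" for B
    using that
  proof (induction B rule: finite_induct)
    case empty
    show ?case using additive_subgroup.zero_closed[OF ideal.axioms(1)[OF assms(1)]] by simp
  next
    case (insert a B)
    then show ?case
      using additive_subgroup.a_closed[OF ideal.axioms(1)[OF assms(1)],
          of "Poly_Mapping.single a (Poly_Mapping.lookup f a)"] monomials by simp
  qed
  then show ?thesis
    by (subst mpoly_eq_sum_monomials) simp
qed

lemma cover_power_1_subset:
  fixes J :: "'k::field mpol set"
  assumes "ideal J (mpoly_ring n)" and C: "C \<subseteq> {1..n}" "\<And>v. v \<in> C \<Longrightarrow> mpoly_var v \<in> J"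
  shows "cover_power n C 1 \<subseteq> J"
proof
  fix f :: "'k mpol" assume f: "f \<in> cover_power n C 1"
  interpret J: ideal J "mpoly_ring n" by (rule assms(1))
  show "f \<in> J"
  proof (rule ideal_mem_if_monomials_mem[OF assms(1)])
    fix a assume a: "a \<in> Poly_Mapping.keys f"
    let ?c = "Poly_Mapping.lookup f a"
    have "weight C a \<noteq> 0"
      using f a by (fastforce simp: cover_power_def)
    then obtain v where v: "v \<in> C" "Poly_Mapping.lookup a v \<noteq> 0"
      unfolding weight_def by (meson sum.not_neutral_contains_not_neutral)
    let ?e = "Poly_Mapping.single v (1 :: nat)"
    have "a = (a - ?e) + ?e"
      by (rule poly_mapping_eqI) (use v(2) in \<open>auto simp: lookup_add lookup_minus lookup_single when_def\<close>)
    then have "Poly_Mapping.single a ?c = Poly_Mapping.single (a - ?e) ?c * mpoly_var v"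
      by (simp add: mpoly_var_def mult_single)
    moreover have "Poly_Mapping.single (a - ?e) ?c \<in> carrier (mpoly_ring n)"
      using f a by (fastforce simp: in_mpoly_ring_iff in_keys_iff lookup_minus cover_power_def subset_iff)
    ultimately show "Poly_Mapping.single a ?c \<in> J"
      using J.I_l_closed[OF C(2)[OF v(1)]] by simp
  qed
qed

section \<open>Powers of ideals and associated primes\<close>

lemma ideals_set_simps [simp]:
  "carrier (ideals_set R) = {I. ideal I R}" "\<one>\<^bsub>ideals_set R\<^esub> = carrier R"
  "I \<otimes>\<^bsub>ideals_set R\<^esub> J = ideal_prod R I J"
  by (simp_all add: ideals_set_def)

lemma (in cring) ideal_ideal_pow:
  assumes "ideal I R"
  shows "ideal (ideal_pow R I k) R"
proof -
  interpret ideals: comm_monoid "ideals_set R" by (rule ideals_set_is_comm_monoid)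
  show ?thesis
    using ideals.nat_pow_closed[of I k] assms by simp
qed

lemma (in cring) ideal_pow_0: "ideal_pow R I 0 = carrier R"
  by (simp add: nat_pow_def)

lemma (in cring) ideal_pow_Suc: "ideal_pow R I (Suc k) = ideal_prod R (ideal_pow R I k) I"
  by (simp add: nat_pow_def)

lemma (in cring) ideal_pow_1:
  assumes "ideal I R"
  shows "ideal_pow R I 1 = I"
proof -
  interpret ideals: comm_monoid "ideals_set R" by (rule ideals_set_is_comm_monoid)
  show ?thesis
    using ideals.nat_pow_Suc[of I 0] ideals.nat_pow_0[of I] ideals.l_one[of I] assms by simp
qed

lemma (in cring) ideal_pow_pow:
  assumes "ideal I R"
  shows "ideal_pow R (ideal_pow R I k) l = ideal_pow R I (k * l)"
proof -
  interpret ideals: comm_monoid "ideals_set R" by (rule ideals_set_is_comm_monoid)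
  show ?thesis
    using ideals.nat_pow_pow[of I k l] assms by simp
qed

text \<open>
  An associated prime is a colon ideal \<open>(J : f)\<close> of a ring element, which replaces the computation
  with cosets.
\<close>

lemma (in cring) ass_quot_iff:
  assumes "ideal J R"
  shows "P \<in> ass_quot R J \<longleftrightarrow>
    primeideal P R \<and> (\<exists>f \<in> carrier R. P = {r \<in> carrier R. r \<otimes> f \<in> J})"
proof -
  interpret J: ideal J R by (rule assms)
  have carr: "carrier (R Quot J) = (\<lambda>f. J +> f) ` carrier R"
    by (auto simp: FactRing_simps)
  have "(J +> r) \<otimes>\<^bsub>R Quot J\<^esub> (J +> f) = \<zero>\<^bsub>R Quot J\<^esub> \<longleftrightarrow> r \<otimes> f \<in> J"
    if "r \<in> carrier R" "f \<in> carrier R" for r f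
  proof -
    have "(J +> r) \<otimes>\<^bsub>R Quot J\<^esub> (J +> f) = J +> (r \<otimes> f)" "\<zero>\<^bsub>R Quot J\<^esub> = J"
      using J.rcoset_mult_add[OF that] by (simp_all add: FactRing_def)
    then show ?thesis
      using J.rcos_const_imp_mem[OF m_closed[OF that]] a_rcos_zero[OF assms] by metis
  qed
  then have "{r \<in> carrier R. (J +> r) \<otimes>\<^bsub>R Quot J\<^esub> (J +> f) = \<zero>\<^bsub>R Quot J\<^esub>} =
      {r \<in> carrier R. r \<otimes> f \<in> J}" if "f \<in> carrier R" for f
    using that by blast
  then show ?thesis
    unfolding ass_quot_def carr by auto
qed

section \<open>Powers of Mengerian edge ideals\<close>

lemma ideal_edge_ideal:
  assumes "\<forall>e \<in> hedges H. e \<subseteq> {1..n}"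
  shows "ideal (edge_ideal n H) (mpoly_ring n :: 'k::field mpol ring)"
proof -
  interpret cring "mpoly_ring n :: 'k mpol ring" by (rule cring_mpoly_ring)
  show ?thesis
    unfolding edge_ideal_def using prod_var_in_carrier assms by (intro genideal_ideal) blast
qed

lemma edge_monomial_in_edge_ideal:
  assumes "\<forall>e \<in> hedges H. e \<subseteq> {1..n}" "e \<in> hedges H"
  shows "(\<Prod>v \<in> e. mpoly_var v) \<in> (edge_ideal n H :: 'k::field mpol set)"
proof -
  interpret cring "mpoly_ring n :: 'k mpol ring" by (rule cring_mpoly_ring)
  have "{(\<Prod>v \<in> e. mpoly_var v) | e. e \<in> hedges H} \<subseteq> carrier (mpoly_ring n :: 'k mpol ring)"
    using prod_var_in_carrier assms(1) by blast
  from genideal_self[OF this] show ?thesis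
    unfolding edge_ideal_def using assms(2) by blast
qed

lemma edge_ideal_pow_subset:
  assumes edges: "\<forall>e \<in> hedges H. e \<subseteq> {1..n}" and C: "C \<in> covers n H"
  shows "ideal_pow (mpoly_ring n) (edge_ideal n H) k \<subseteq> (cover_power n C k :: 'k::field mpol set)"
proof (induction k)
  interpret cring "mpoly_ring n :: 'k mpol ring" by (rule cring_mpoly_ring)
  case 0
  show ?case by (simp add: ideal_pow_0 cover_power_0)
next
  interpret cring "mpoly_ring n :: 'k mpol ring" by (rule cring_mpoly_ring)
  case (Suc k)
  have C': "C \<subseteq> {1..n}" "\<And>e. e \<in> hedges H \<Longrightarrow> C \<inter> e \<noteq> {}"
    using C by (auto simp: covers_def)
  have base: "edge_ideal n H \<subseteq> (cover_power n C 1 :: 'k mpol set)"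
    unfolding edge_ideal_def
    by (rule genideal_minimal[OF ideal_cover_power])
      (use edges C' in \<open>auto simp del: One_nat_def simp: prod_var_in_cover_power_iff\<close>)
  have "f \<in> cover_power n C (Suc k)"
    if "f \<in> ideal_prod (mpoly_ring n) (ideal_pow (mpoly_ring n) (edge_ideal n H) k) (edge_ideal n H)"
    for f :: "'k mpol"
    using that
  proof induction
    case (prod g h)
    then show ?case
      using cover_power_mult[of g n C k h 1] base Suc by auto
  qed (simp add: cover_power_add)
  then show ?case
    unfolding ideal_pow_Suc by blast
qed

lemma edge_product_in_pow:
  assumes edges: "\<forall>e \<in> hedges H. e \<subseteq> {1..n}"
    and e: "\<And>i. i < k \<Longrightarrow> e i \<in> hedges H"
  shows "(\<Prod>i<k. \<Prod>v \<in> e i. mpoly_var v) \<in>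
    (ideal_pow (mpoly_ring n) (edge_ideal n H) k :: 'k::field mpol set)"
  using e
proof (induction k)
  interpret cring "mpoly_ring n :: 'k mpol ring" by (rule cring_mpoly_ring)
  case 0
  show ?case using one_closed by (simp add: ideal_pow_0)
next
  interpret cring "mpoly_ring n :: 'k mpol ring" by (rule cring_mpoly_ring)
  case (Suc k)
  then show ?case
    using ideal_prod.prod[OF Suc.IH edge_monomial_in_edge_ideal[OF edges, of "e k"], of "mpoly_ring n"]
    by (simp add: ideal_pow_Suc mult.commute)
qed

text \<open>
  A packing of \<open>k\<close> edges below the exponent vector \<open>a\<close> exhibits \<open>x\<^sup>a\<close> as a multiple
  of a product of \<open>k\<close> generators.
\<close>

lemma packed_monomial_in_pow:
  assumes edges: "\<forall>e \<in> hedges H. e \<subseteq> {1..n}"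
    and e: "\<And>i. i < k \<Longrightarrow> e i \<in> hedges H"
    and load: "\<And>v. card {i. i < k \<and> v \<in> e i} \<le> Poly_Mapping.lookup a v"
    and a: "Poly_Mapping.keys a \<subseteq> {1..n}"
  shows "Poly_Mapping.single a c \<in>
    (ideal_pow (mpoly_ring n) (edge_ideal n H) k :: 'k::field mpol set)"
proof -
  interpret cring "mpoly_ring n :: 'k mpol ring" by (rule cring_mpoly_ring)
  define b where "b = (\<Sum>i<k. indicator_monomial (e i))"
  have prod: "(\<Prod>i<l. \<Prod>v \<in> e i. mpoly_var v) =
      (Poly_Mapping.single (\<Sum>i<l. indicator_monomial (e i)) 1 :: 'k mpol)" for l
    by (induction l) (simp_all add: prod_var_eq_single mult_single)
  have lookup_b: "Poly_Mapping.lookup b v = card {i. i < k \<and> v \<in> e i}" for v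
  proof -
    have "finite (e i)" if "i < k" for i
      using edges e[OF that] finite_subset by blast
    then have "Poly_Mapping.lookup b v = (\<Sum>i<k. if v \<in> e i then 1 else 0)"
      unfolding b_def lookup_sum by (intro sum.cong) (auto simp: lookup_indicator_monomial)
    also have "\<dots> = card ({..<k} \<inter> {i. v \<in> e i})"
      by (simp add: sum.If_cases)
    also have "{..<k} \<inter> {i. v \<in> e i} = {i. i < k \<and> v \<in> e i}" by auto
    finally show ?thesis .
  qed
  have "a = (a - b) + b"
    by (rule poly_mapping_eqI) (simp add: lookup_add lookup_minus lookup_b load)
  then have "Poly_Mapping.single a c =
      Poly_Mapping.single (a - b) c * (\<Prod>i<k. \<Prod>v \<in> e i. mpoly_var v)"
    by (simp add: prod mult_single flip: b_def)
  moreover have "Poly_Mapping.single (a - b) c \<in> carrier (mpoly_ring n)"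
    using a by (auto simp: in_mpoly_ring_iff in_keys_iff lookup_minus subset_iff)
  moreover have "ideal (ideal_pow (mpoly_ring n) (edge_ideal n H) k) (mpoly_ring n :: 'k mpol ring)"
    by (intro ideal_ideal_pow ideal_edge_ideal[OF edges])
  ultimately show ?thesis
    using ideal.I_l_closed[OF _ edge_product_in_pow[OF edges]] e by fastforce
qed

text \<open>
  The ordinary powers coincide with the symbolic powers. The cover conditions are necessary since every
  generator has weight at least \<open>1\<close> on each cover. They are sufficient monomial by monomial, because
  the max-flow min-cut property turns them into a packing of \<open>k\<close> edges.
\<close>

theorem mengerian_edge_ideal_pow:
  assumes edges: "\<forall>e \<in> hedges H. e \<subseteq> {1..n}" and H: "mengerian n H"
  shows "f \<in> ideal_pow (mpoly_ring n) (edge_ideal n H) k \<longleftrightarrow>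
    f \<in> carrier (mpoly_ring n :: 'k::field mpol ring) \<and> (\<forall>C \<in> covers n H. f \<in> cover_power n C k)"
proof -
  interpret cring "mpoly_ring n :: 'k mpol ring" by (rule cring_mpoly_ring)
  let ?J = "ideal_pow (mpoly_ring n) (edge_ideal n H) k :: 'k mpol set"
  interpret J: ideal ?J "mpoly_ring n"
    by (intro ideal_ideal_pow ideal_edge_ideal[OF edges])
  show ?thesis
  proof
    assume "f \<in> ?J"
    then show "f \<in> carrier (mpoly_ring n) \<and> (\<forall>C \<in> covers n H. f \<in> cover_power n C k)"
      using J.Icarr edge_ideal_pow_subset[OF edges] by blast
  next
    assume f: "f \<in> carrier (mpoly_ring n) \<and> (\<forall>C \<in> covers n H. f \<in> cover_power n C k)"
    have "Poly_Mapping.single a (Poly_Mapping.lookup f a) \<in> ?J" if a: "a \<in> Poly_Mapping.keys f" for a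
    proof -
      have "\<forall>C \<in> covers n H. k \<le> sum (Poly_Mapping.lookup a) C"
        using f a by (auto simp: cover_power_def weight_def)
      then obtain e where "\<forall>i<k. e i \<in> hedges H"
        "\<forall>v. card {i. i < k \<and> v \<in> e i} \<le> Poly_Mapping.lookup a v"
        using H unfolding mengerian_def by blast
      then show ?thesis
        using f a by (intro packed_monomial_in_pow[OF edges]) (auto simp: in_mpoly_ring_iff)
    qed
    then show "f \<in> ?J"
      by (rule ideal_mem_if_monomials_mem[OF J.is_ideal])
  qed
qed

section \<open>Associated primes\<close>

text \<open>
  Let \<open>P = (I\<^sup>k : f)\<close> be prime. The product \<open>w\<close> of the variables outside \<open>P\<close> has no power
  in \<open>P\<close>, so \<open>w\<^sup>k f\<close> violates the condition of some cover \<open>C\<close>. This forces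
  \<open>C\<close> to consist of variables in \<open>P\<close>, while the order along \<open>C\<close> bounds \<open>P\<close> from
  above; hence \<open>P\<close> is the prime ideal generated by the variables in \<open>C\<close>. The same upper bound
  for smaller covers shows that \<open>C\<close> is minimal, and then \<open>P = (I : g)\<close>, where \<open>g\<close> is the
  product of the variables outside \<open>C\<close>: a cover \<open>C'\<close> with \<open>g\<close> of order \<open>0\<close> lies
  inside \<open>C\<close>, so it equals \<open>C\<close>.
\<close>

theorem mengerian_normally_torsion_free:
  assumes edges: "\<forall>e \<in> hedges H. e \<subseteq> {1..n}" and H: "mengerian n H"
  shows "normally_torsion_free (mpoly_ring n) (edge_ideal n H :: 'k::field mpol set)"
  unfolding normally_torsion_free_def
proof (intro allI impI subsetI)
  let ?R = "mpoly_ring n :: 'k mpol ring"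
  let ?I = "edge_ideal n H :: 'k mpol set"
  interpret cring ?R by (rule cring_mpoly_ring)
  have I: "ideal ?I ?R"
    by (rule ideal_edge_ideal[OF edges])
  note pow_iff = mengerian_edge_ideal_pow[OF edges H]
  have I_iff: "h \<in> ?I \<longleftrightarrow> h \<in> carrier ?R \<and> (\<forall>C \<in> covers n H. h \<in> cover_power n C 1)" for h
    using pow_iff[of h 1] unfolding ideal_pow_1[OF I] .
  fix k :: nat and P assume "k \<ge> 1" and "P \<in> ass_quot ?R (ideal_pow ?R ?I k)"
  then obtain f where P: "primeideal P ?R" and f: "f \<in> carrier ?R"
    and P_eq: "P = {r \<in> carrier ?R. r * f \<in> ideal_pow ?R ?I k}"
    unfolding ass_quot_iff[OF ideal_ideal_pow[OF I]] by auto
  interpret P: primeideal P ?R by (rule P)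
  have prime_prod: "(\<Prod>v \<in> A. mpoly_var v) \<notin> P" if "A \<subseteq> {1..n}" "\<forall>v \<in> A. mpoly_var v \<notin> P" for A
  proof -
    have "finite A" using that(1) finite_subset by blast
    then show ?thesis
      using that
    proof (induction A rule: finite_induct)
      case empty
      show ?case using P.one_imp_carrier P.I_notcarr by auto
    next
      case (insert v A)
      have "mpoly_var v \<in> carrier ?R" "(\<Prod>v \<in> A. mpoly_var v) \<in> carrier ?R"
        using prod_var_in_carrier[of "{v}" n, where 'k = 'k] prod_var_in_carrier[of A n, where 'k = 'k]
          insert.prems by auto
      then show ?case
        using P.I_prime[of "mpoly_var v" "\<Prod>v \<in> A. mpoly_var v"] insert by auto
    qed
  qed
  have prime_pow: "g ^ m \<notin> P" if "g \<in> carrier ?R" "g \<notin> P" for g m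
  proof (induction m)
    case 0
    show ?case using P.one_imp_carrier P.I_notcarr by auto
  next
    case (Suc m)
    have "g ^ m \<in> carrier ?R"
      using nat_pow_closed[OF that(1), of m] by simp
    then show ?case
      using P.I_prime[of g "g ^ m"] that Suc by auto
  qed
  have upper: "P \<subseteq> cover_power n C 1" if "C \<in> covers n H" "f \<notin> cover_power n C k" for C
  proof
    fix r assume "r \<in> P"
    then have r: "r \<in> carrier ?R" "r * f \<in> ideal_pow ?R ?I k"
      unfolding P_eq by blast+
    then have "r * f \<in> cover_power n C k"
      using that(1) unfolding pow_iff by blast
    then show "r \<in> cover_power n C 1"
      by (rule cover_power_colon[OF r(1) f that(2)])
  qed
  define W where "W = {v \<in> {1..n}. (mpoly_var v :: 'k mpol) \<notin> P}"
  define w :: "'k mpol" where "w = (\<Prod>v \<in> W. mpoly_var v)"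
  have w: "w \<in> carrier ?R" "w \<notin> P"
    unfolding w_def by (rule prod_var_in_carrier prime_prod; auto simp: W_def)+
  have wk: "w ^ k \<in> carrier ?R"
    using nat_pow_closed[OF w(1), of k] by simp
  then have "w ^ k * f \<notin> ideal_pow ?R ?I k"
    using prime_pow[OF w] unfolding P_eq by blast
  then obtain C where C: "C \<in> covers n H" and wf: "w ^ k * f \<notin> cover_power n C k"
    using m_closed[OF wk f] unfolding pow_iff by auto
  have fC: "f \<notin> cover_power n C k"
    using wf cover_power_absorb[OF wk] by blast
  have "w \<notin> cover_power n C 1"
  proof
    assume "w \<in> cover_power n C 1"
    then have "w ^ k * f \<in> cover_power n C (k + 0)"
      using cover_power_mult[OF cover_power_power[of w n C 1 k], of f 0] f by (simp add: cover_power_0)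
    then show False using wf by simp
  qed
  moreover have "W \<subseteq> {1..n}" "C \<subseteq> {1..n}"
    using C by (auto simp: W_def covers_def)
  ultimately have CW: "C \<inter> W = {}"
    using prod_var_in_cover_power_iff[of W n C, where 'k = 'k] unfolding w_def by blast
  have var_in_P: "mpoly_var v \<in> P" if "v \<in> C" for v
  proof -
    have "v \<in> {1..n}" "v \<notin> W"
      using that C CW by (auto simp: covers_def)
    then show ?thesis by (simp add: W_def)
  qed
  have minimal: "C' = C" if C': "C' \<in> covers n H" "C' \<subseteq> C" for C'
  proof -
    have "weight C' a \<le> weight C a" for a
      unfolding weight_def using C C'(2) finite_subset[of C "{1..n}"]
      by (intro sum_mono2) (auto simp: covers_def)
    then have "f \<notin> cover_power n C' k"
      using fC by (force simp: cover_power_def intro: order_trans)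
    then have P_sub: "P \<subseteq> cover_power n C' 1"
      using upper[OF C'(1)] by simp
    have sub: "C' \<subseteq> {1..n}" "C \<subseteq> {1..n}"
      using C C'(1) by (simp_all add: covers_def)
    have "C \<subseteq> C'"
    proof
      fix v assume v: "v \<in> C"
      have "(\<Prod>u \<in> {v}. mpoly_var u) \<in> (cover_power n C' 1 :: 'k mpol set)"
        using P_sub var_in_P[OF v] by auto
      then have "C' \<inter> {v} \<noteq> {}"
        using prod_var_in_cover_power_iff[of "{v}" n C', where 'k = 'k] sub v by blast
      then show "v \<in> C'" by blast
    qed
    then show ?thesis using C'(2) by blast
  qed
  define g :: "'k mpol" where "g = (\<Prod>v \<in> {1..n} - C. mpoly_var v)"
  have g: "g \<in> carrier ?R"
    unfolding g_def by (rule prod_var_in_carrier) auto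
  have g_iff: "g \<in> cover_power n C' 1 \<longleftrightarrow> \<not> C' \<subseteq> C" if "C' \<in> covers n H" for C'
    using that unfolding g_def by (subst prod_var_in_cover_power_iff) (auto simp: covers_def)
  have "r * g \<in> ?I \<longleftrightarrow> r \<in> P" if r: "r \<in> carrier ?R" for r
  proof
    assume "r * g \<in> ?I"
    then have "r \<in> cover_power n C 1"
      using cover_power_colon[OF r g, of C 1] g_iff[OF C] C by (simp add: I_iff del: One_nat_def)
    then show "r \<in> P"
      using cover_power_1_subset[OF P.is_ideal _ var_in_P] C by (auto simp: covers_def)
  next
    assume "r \<in> P"
    have "r * g \<in> cover_power n C' 1" if C': "C' \<in> covers n H" for C'
    proof (cases "C' \<subseteq> C")
      case True
      then have "r \<in> cover_power n C' 1"
        using minimal[OF C' True] upper[OF C fC] \<open>r \<in> P\<close> by blast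
      then show ?thesis
        using cover_power_absorb[OF g] by (subst mult.commute)
    next
      case False
      then show ?thesis
        using g_iff[OF C'] by (intro cover_power_absorb r) simp
    qed
    then show "r * g \<in> ?I"
      using m_closed[OF r g] by (simp add: I_iff del: One_nat_def)
  qed
  then have "P = {r \<in> carrier ?R. r \<otimes>\<^bsub>?R\<^esub> g \<in> ?I}"
    using P.Icarr by auto
  then show "P \<in> ass_quot ?R ?I"
    unfolding ass_quot_iff[OF I] using P g by blast
qed

section \<open>Integral closure\<close>

text \<open>
  In an equation of integral dependence of \<open>f\<close> over \<open>I\<^sup>k\<close>, suppose that the order \<open>q\<close> of
  \<open>f\<close> along a cover is less than \<open>k\<close>. Every term but \<open>f\<^sup>m\<close> then has order at least
  \<open>k i + (m - i) q > m q\<close>, whereas \<open>f\<^sup>m\<close> has order exactly \<open>m q\<close>, which is absurd.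
\<close>

theorem mengerian_normal_ideal:
  assumes edges: "\<forall>e \<in> hedges H. e \<subseteq> {1..n}" and H: "mengerian n H"
  shows "normal_ideal (mpoly_ring n) (edge_ideal n H :: 'k::field mpol set)"
  unfolding normal_ideal_def integrally_closed_def
proof (intro allI impI equalityI subsetI)
  let ?R = "mpoly_ring n :: 'k mpol ring"
  let ?I = "edge_ideal n H :: 'k mpol set"
  interpret cring ?R by (rule cring_mpoly_ring)
  have I: "ideal ?I ?R"
    by (rule ideal_edge_ideal[OF edges])
  note pow_iff = mengerian_edge_ideal_pow[OF edges H]
  fix k :: nat and f :: "'k mpol"
  interpret Ik: ideal "ideal_pow ?R ?I k" ?R
    by (rule ideal_ideal_pow[OF I])
  {
    assume "f \<in> integral_closure ?R (ideal_pow ?R ?I k)"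
    then obtain m a where f: "f \<in> carrier ?R" and "m \<ge> 1"
      and a: "\<forall>i \<in> {1..m}. a i \<in> ideal_pow ?R (ideal_pow ?R ?I k) i"
      and eq: "f ^ m + finsum ?R (\<lambda>i. a i * f ^ (m - i)) {1..m} = 0"
      unfolding integral_closure_def by auto
    have a_pow: "a i \<in> ideal_pow ?R ?I (k * i)" if "i \<in> {1..m}" for i
      using a that by (simp add: ideal_pow_pow[OF I])
    have "a i \<in> carrier ?R" if "i \<in> {1..m}" for i
      using a_pow[OF that] by (simp add: pow_iff)
    then have "finsum ?R (\<lambda>i. a i * f ^ (m - i)) {1..m} = (\<Sum>i \<in> {1..m}. a i * f ^ (m - i))"
      using f m_closed nat_pow_closed[OF f] by (intro mpoly_ring_finsum) auto
    then have f_pow: "f ^ m = - (\<Sum>i \<in> {1..m}. a i * f ^ (m - i))"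
      using eq by (simp add: eq_neg_iff_add_eq_0)
    have "f \<in> cover_power n C k" if C: "C \<in> covers n H" for C
    proof (rule ccontr)
      assume notin: "f \<notin> cover_power n C k"
      then have "f \<noteq> 0"
        by (auto simp: cover_power_def in_mpoly_ring_iff)
      define q where "q = cover_order C f"
      have "q < k" and fq: "f \<in> cover_power n C q"
        using notin f \<open>f \<noteq> 0\<close> by (auto simp: mem_cover_power_iff_cover_order q_def)
      have "a i * f ^ (m - i) \<in> cover_power n C (Suc (m * q))" if i: "i \<in> {1..m}" for i
      proof -
        have "a i \<in> cover_power n C (k * i)"
          using a_pow[OF i] C by (simp add: pow_iff)
        then have "a i * f ^ (m - i) \<in> cover_power n C (k * i + (m - i) * q)"
          by (intro cover_power_mult cover_power_power fq)
        moreover have "Suc (m * q) \<le> k * i + (m - i) * q"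
        proof -
          have "m * q = i * q + (m - i) * q"
            using i by (simp flip: add_mult_distrib)
          moreover have "i * q < k * i"
            using i \<open>q < k\<close> by (simp add: mult.commute)
          ultimately show ?thesis by linarith
        qed
        ultimately show ?thesis
          using cover_power_antimono by blast
      qed
      then have "(\<Sum>i \<in> {1..m}. a i * f ^ (m - i)) \<in> cover_power n C (Suc (m * q))"
        by (intro cover_power_sum) auto
      then have "f ^ m \<in> cover_power n C (Suc (m * q))"
        unfolding f_pow by (rule cover_power_uminus)
      then show False
        using \<open>f \<noteq> 0\<close> by (simp add: mem_cover_power_iff_cover_order cover_order_power q_def)
    qed
    then show "f \<in> ideal_pow ?R ?I k"
      using f by (simp add: pow_iff)
  }
  {
    assume f: "f \<in> ideal_pow ?R ?I k"
    then have carr: "f \<in> carrier ?R" "\<ominus>\<^bsub>?R\<^esub> f \<in> carrier ?R"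
      by (simp_all add: Ik.Icarr)
    \<comment> \<open>The witness is the linear equation \<open>f + (-f) = 0\<close>.\<close>
    have "f [^]\<^bsub>?R\<^esub> (1 :: nat) \<oplus>\<^bsub>?R\<^esub>
      (\<Oplus>\<^bsub>?R\<^esub>i \<in> {1..1 :: nat}. (\<ominus>\<^bsub>?R\<^esub> f) \<otimes>\<^bsub>?R\<^esub> f [^]\<^bsub>?R\<^esub> (1 - i)) = \<zero>\<^bsub>?R\<^esub>"
      using r_neg[OF carr(1)] mpoly_ring_finsum[of "{1 :: nat}" "\<lambda>i. (\<ominus>\<^bsub>?R\<^esub> f) * f ^ (1 - i)" n] carr
      by simp
    moreover have "\<forall>i \<in> {1..1 :: nat}. \<ominus>\<^bsub>?R\<^esub> f \<in> ideal_pow ?R (ideal_pow ?R ?I k) i"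
      using ideal_pow_1[OF Ik.is_ideal] Ik.a_inv_closed[OF f] by simp
    ultimately show "f \<in> integral_closure ?R (ideal_pow ?R ?I k)"
      unfolding integral_closure_def using carr(1)
      by (intro CollectI conjI exI[of _ 1] exI[of _ "\<lambda>_. \<ominus>\<^bsub>?R\<^esub> f"]) auto
  }
qed

section \<open>Complete spread hypergraphs\<close>

theorem theorem4p6:
  fixes n d :: nat
    and t :: "nat \<Rightarrow> int"
    and V :: "nat \<Rightarrow> nat set"
    and i m :: "nat \<Rightarrow> nat"
    and I :: "'k::field mpol set"
  assumes "n \<ge> 1" and "d \<ge> 1"
    and "\<forall>j \<in> {1..d - 1}. t j \<ge> 1"
    and "ordered_family n d V"
    and "\<forall>j \<in> {1..d}. card (V j) = m j \<and> V j = {i j..i j + m j - 1}"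
    and "no_isolated_vertices (complete_spread_hypergraph d t V)"
    and "I = edge_ideal n (complete_spread_hypergraph d t V)"
  shows "normally_torsion_free (mpoly_ring n) I \<and> normal_ideal (mpoly_ring n) I"
  using mengerian_normally_torsion_free mengerian_normal_ideal
    mengerian_complete_spread_hypergraph[OF assms(2-4)] edge_subset_vertices[OF assms(4)]
  unfolding assms(7) by blast

end
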